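(* There exists an absolute constant $C$ such that for every finite set $A\subset\mathbb{Z}$ we have $$|A+3\cdot A|\geq 4|A|-C.$$
   Context: For sets $A,B\subset\mathbb{Z}$, the sumset is $A+B=\{a+b: a\in A,\ b\in B\}$. For an integer $\lambda$, the dilate of $A$ by $\lambda$ is $\lambda\cdot A=\{\lambda a: a\in A\}$. $|A|$ denotes the cardinality of $A$. *)

theory Defs
  imports Complex_Main "HOL-Library.Set_Algebras"
begin

end

theory Submission
  imports Defs
begin

text \<open>Split \<open>A\<close> into its classes \<open>3 \<cdot> X + r\<close> modulo 3; then \<open>|A + 3 \<cdot> A|\<close> is the sum of the \<open>|X + A|\<close>.
  If all three classes occur, \<open>|X + A| \<ge> |X| + |A| - 1\<close> gives \<open>4|A| - 3\<close>. If only one class occurs,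
  replace \<open>A\<close> by \<open>X\<close>, which has smaller diameter. If two classes \<open>X\<close> and \<open>W\<close> occur, use induction on
  the diameter: whenever \<open>X\<close> misses a residue modulo 3, the part \<open>X + 3 \<cdot> W + s\<close> of \<open>X + A\<close> meets a
  residue class avoided by \<open>X + 3 \<cdot> X + r\<close>, so \<open>|X + A| \<ge> |X + 3 \<cdot> X| + |W|\<close>. These extra terms
  compensate for the accumulated constants.\<close>

section \<open>Residue classes modulo 3 and sumsets\<close>

definition aff :: "int set \<Rightarrow> int \<Rightarrow> int set" where
  "aff X r = (\<lambda>x. 3 * x + r) ` X"

definition full :: "int set \<Rightarrow> bool" where
  "full X \<longleftrightarrow> (\<forall>r. \<exists>x\<in>X. x mod 3 = r mod 3)"

lemma card_aff [simp]: "card (aff X r) = card X"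
  unfolding aff_def by (rule card_image) (auto simp: inj_on_def)

lemma finite_aff [simp]: "finite (aff X r) \<longleftrightarrow> finite X"
  unfolding aff_def by (rule finite_image_iff) (auto simp: inj_on_def)

lemma aff_empty [simp]: "aff {} r = {}"
  by (simp add: aff_def)

lemma aff_disjoint: "r mod 3 \<noteq> s mod 3 \<Longrightarrow> aff X r \<inter> aff W s = {}"
  unfolding aff_def by auto presburger

lemma card_aff_Un:
  assumes "finite X" "finite W" "r mod 3 \<noteq> s mod 3"
  shows "card (aff X r \<union> aff W s) = card X + card W"
  using assms by (simp add: card_Un_disjoint aff_disjoint)

lemma mem_sumset_dilate: "x \<in> X \<Longrightarrow> a \<in> A \<Longrightarrow> z = x + c * a \<Longrightarrow> z \<in> X + c *o (A::int set)"
  unfolding set_plus_def elt_set_times_def by blast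

lemma mem_sumset: "x \<in> X \<Longrightarrow> a \<in> A \<Longrightarrow> z = x + a \<Longrightarrow> z \<in> X + (A::int set)"
  unfolding set_plus_def by blast

lemma mem_sumset_dilateE:
  assumes "z \<in> X + c *o (A::int set)"
  obtains x a where "x \<in> X" "a \<in> A" "z = x + c * a"
  using assms unfolding set_plus_def elt_set_times_def by blast

lemma mem_aff: "x \<in> X \<Longrightarrow> z = 3 * x + r \<Longrightarrow> z \<in> aff X r"
  unfolding aff_def by blast

text \<open>Adding a multiple of 3 preserves the residue, so \<open>A + 3 *o A\<close> splits along
  the classes of the left summand alone. This turns the problem into bounding \<open>X + A\<close>
  for each class.\<close>

lemma aff_sumset: "aff X r + 3 *o A = aff (X + A) r"
proof (intro set_eqI iffI)
  fix z assume "z \<in> aff X r + 3 *o A"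
  then obtain x a where "x \<in> X" "a \<in> A" "z = 3 * x + r + 3 * a"
    by (auto simp: aff_def elim!: mem_sumset_dilateE)
  then show "z \<in> aff (X + A) r"
    by (intro mem_aff[of "x + a"] mem_sumset[of x X a A]) simp_all
next
  fix z assume "z \<in> aff (X + A) r"
  then obtain x a where "x \<in> X" "a \<in> A" "z = 3 * (x + a) + r"
    by (auto simp: aff_def elim!: set_plus_elim)
  then show "z \<in> aff X r + 3 *o A"
    by (intro mem_sumset_dilate[of "3 * x + r" _ a] mem_aff[of x]) simp_all
qed

text \<open>With \<open>W = X\<close> this finds a translate of \<open>X + 3 *o X\<close> inside
  \<open>X + A\<close>, which is what makes induction possible.\<close>

lemma sumset_aff: "X + aff W r = (\<lambda>z. z + r) ` (X + 3 *o W)"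
proof (intro set_eqI iffI)
  fix z assume "z \<in> X + aff W r"
  then obtain x w where "x \<in> X" "w \<in> W" "z = x + (3 * w + r)"
    by (auto simp: aff_def elim!: set_plus_elim)
  then show "z \<in> (\<lambda>z. z + r) ` (X + 3 *o W)"
    by (intro image_eqI[of _ _ "x + 3 * w"] mem_sumset_dilate[of x X w W]) simp_all
next
  fix z assume "z \<in> (\<lambda>z. z + r) ` (X + 3 *o W)"
  then obtain x w where "x \<in> X" "w \<in> W" "z = x + 3 * w + r"
    by (auto elim!: mem_sumset_dilateE)
  then show "z \<in> X + aff W r"
    by (intro mem_sumset[of x X "3 * w + r"] mem_aff[of w]) simp_all
qed

lemma Un_sumset: "(A \<union> B) + C = (A + C) \<union> (B + (C::int set))"
  unfolding set_plus_def by auto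

lemma finite_dilate: "finite A \<Longrightarrow> finite (c *o (A::int set))"
proof -
  have "c *o A = (*) c ` A" by (auto simp: elt_set_times_def)
  then show "finite A \<Longrightarrow> finite (c *o A)" by simp
qed

lemma aff_classes:
  "A = aff {x. 3 * x \<in> A} 0 \<union> aff {x. 3 * x + 1 \<in> A} 1 \<union> aff {x. 3 * x + 2 \<in> A} 2"
proof -
  have "a \<in> A \<Longrightarrow> a \<in> aff {x. 3 * x \<in> A} 0 \<union> aff {x. 3 * x + 1 \<in> A} 1 \<union> aff {x. 3 * x + 2 \<in> A} 2" for a
  proof -
    assume a: "a \<in> A"
    have "a = 3 * (a div 3) \<or> a = 3 * (a div 3) + 1 \<or> a = 3 * (a div 3) + 2" by presburger
    with a show ?thesis unfolding aff_def by force
  qed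
  then show ?thesis by (auto simp: aff_def)
qed

section \<open>The sumset bound and the case of three classes\<close>

text \<open>The translates \<open>X + Min Y\<close> and \<open>Max X + Y\<close> both lie in the
  sumset and share only the point \<open>Max X + Min Y\<close>.\<close>

lemma card_sumset_ge:
  fixes X Y :: "int set"
  assumes "finite X" "finite Y" "X \<noteq> {}" "Y \<noteq> {}"
  shows "card X + card Y \<le> card (X + Y) + 1"
proof -
  let ?P = "(\<lambda>x. x + Min Y) ` X" and ?Q = "(\<lambda>y. Max X + y) ` Y"
  have sub: "?P \<union> ?Q \<subseteq> X + Y"
    using Max_in[OF assms(1,3)] Min_in[OF assms(2,4)] by auto
  have "z = Max X + Min Y" if "z \<in> ?P \<inter> ?Q" for z
  proof -
    from that obtain x y where xy: "x \<in> X" "y \<in> Y" "z = x + Min Y" "z = Max X + y" by blast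
    have "x \<le> Max X" "Min Y \<le> y" using xy assms by auto
    then show ?thesis using xy by linarith
  qed
  then have "card (?P \<inter> ?Q) \<le> card {Max X + Min Y}"
    by (intro card_mono) auto
  moreover have "card ?P + card ?Q = card (?P \<union> ?Q) + card (?P \<inter> ?Q)"
    using assms by (intro card_Un_Int) auto
  moreover have "card ?P = card X" "card ?Q = card Y"
    by (auto intro!: card_image simp: inj_on_def)
  moreover have "card (?P \<union> ?Q) \<le> card (X + Y)"
    using sub assms by (intro card_mono finite_set_plus)
  ultimately show ?thesis by simp
qed

lemma card_full:
  assumes "finite A" "full A"
  shows "4 * card A \<le> card (A + 3 *o A) + 3"
proof -
  define X0 X1 X2 where X: "X0 = {x. 3 * x \<in> A}" "X1 = {x. 3 * x + 1 \<in> A}" "X2 = {x. 3 * x + 2 \<in> A}"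
  have A: "A = aff X0 0 \<union> aff X1 1 \<union> aff X2 2" unfolding X by (rule aff_classes)
  have fin: "finite X0" "finite X1" "finite X2"
    using \<open>finite A\<close> finite_aff by (metis A finite_Un)+
  have disj: "(aff U 0 \<union> aff V 1) \<inter> aff W 2 = {}" for U V W
    using aff_disjoint[of 0 2 U W] aff_disjoint[of 1 2 V W] by auto
  have card3: "card (aff U 0 \<union> aff V 1 \<union> aff W 2) = card U + card V + card W"
    if "finite U" "finite V" "finite W" for U V W
    using that by (simp add: card_Un_disjoint disj card_aff_Un)
  obtain a b c where abc: "a \<in> A" "b \<in> A" "c \<in> A" "a mod 3 = 0" "b mod 3 = 1" "c mod 3 = 2"
    using \<open>full A\<close>[unfolded full_def, rule_format, of 0]
      \<open>full A\<close>[unfolded full_def, rule_format, of 1]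
      \<open>full A\<close>[unfolded full_def, rule_format, of 2] by auto
  have "3 * (a div 3) = a" "3 * (b div 3) + 1 = b" "3 * (c div 3) + 2 = c"
    using abc by presburger+
  then have ne: "X0 \<noteq> {}" "X1 \<noteq> {}" "X2 \<noteq> {}" "A \<noteq> {}"
    using abc unfolding X by (metis (mono_tags) empty_iff mem_Collect_eq)+
  have cA: "card A = card X0 + card X1 + card X2" using card3[OF fin] A by simp
  \<comment> \<open>Only the left summand is split; the right one stays whole, so each class is
    added to all of \<open>A\<close>.\<close>
  have "A + 3 *o A = aff (X0 + A) 0 \<union> aff (X1 + A) 1 \<union> aff (X2 + A) 2"
    by (subst (1) A) (simp only: Un_sumset aff_sumset)
  then have "card (A + 3 *o A) = card (X0 + A) + card (X1 + A) + card (X2 + A)"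
    using card3 fin \<open>finite A\<close> by (simp add: finite_set_plus)
  moreover note card_sumset_ge[OF fin(1) \<open>finite A\<close> ne(1,4)]
    card_sumset_ge[OF fin(2) \<open>finite A\<close> ne(2,4)] card_sumset_ge[OF fin(3) \<open>finite A\<close> ne(3,4)]
  ultimately show ?thesis using cA by linarith
qed

section \<open>Sets that miss a residue modulo 3\<close>

text \<open>Otherwise the residues of \<open>X\<close> would be closed under adding
  \<open>d = s - r\<close>. As \<open>d\<close> is nonzero modulo 3, the residues of
  \<open>x\<close>, \<open>x + d\<close> and \<open>x + 2 * d\<close> are all of them, so
  \<open>X\<close> would be full.\<close>

lemma not_full_shift:
  assumes "X \<noteq> {}" "\<not> full X" "r mod 3 \<noteq> s mod 3"
  shows "\<exists>x\<in>X. \<forall>y\<in>X. (x + s) mod 3 \<noteq> (y + r) mod 3"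
proof (rule ccontr)
  assume "\<not> ?thesis"
  then have step: "\<exists>y\<in>X. (x + s) mod 3 = (y + r) mod 3" if "x \<in> X" for x using that by blast
  obtain x where x: "x \<in> X" using assms by blast
  obtain y where y: "y \<in> X" "(x + s) mod 3 = (y + r) mod 3" using step x by blast
  obtain z where z: "z \<in> X" "(y + s) mod 3 = (z + r) mod 3" using step y by blast
  obtain k where k: "y + r = x + s + 3 * k" using y(2) by (rule mod_eqE)
  obtain l where l: "z + r = y + s + 3 * l" using z(2) by (rule mod_eqE)
  define d where "d = s - r"
  have "y = x + d + 3 * k" "z = x + 2 * d + 3 * (k + l)" using k l by (auto simp: d_def)
  then have "y mod 3 = (x + d) mod 3" "z mod 3 = (x + 2 * d) mod 3"
    by (simp_all only: mod_mult_self2)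
  moreover have "d mod 3 \<noteq> 0" using assms(3) 
    by (metis d_def diff_add_cancel mod_add_left_eq add_0)
  then have "3 dvd u \<or> 3 dvd u - d \<or> 3 dvd u - 2 * d" for u
    by presburger
  then have "t mod 3 = x mod 3 \<or> t mod 3 = (x + d) mod 3 \<or> t mod 3 = (x + 2 * d) mod 3" for t
    unfolding mod_eq_dvd_iff diff_diff_eq[symmetric] by blast
  ultimately have "t mod 3 = x mod 3 \<or> t mod 3 = y mod 3 \<or> t mod 3 = z mod 3" for t
    by simp
  then have "full X" unfolding full_def using x y z by metis
  with assms show False by blast
qed

lemma card_not_full:
  assumes "finite X" "finite W" "X \<noteq> {}" "\<not> full X" "r mod 3 \<noteq> s mod 3"
  shows "card (X + 3 *o X) + card W \<le> card (X + (aff X r \<union> aff W s))"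
proof -
  obtain x where x: "x \<in> X" "\<forall>y\<in>X. (x + s) mod 3 \<noteq> (y + r) mod 3"
    using not_full_shift[OF assms(3-5)] by blast
  \<comment> \<open>\<open>?P\<close> is \<open>X + aff X r\<close>, and \<open>?Q\<close> is the
    single translate of \<open>aff W s\<close> by \<open>x\<close>. All of \<open>?Q\<close> has the
    residue of \<open>x + s\<close>, which \<open>?P\<close> avoids by the choice of
    \<open>x\<close>.\<close>
  let ?P = "(\<lambda>z. z + r) ` (X + 3 *o X)" and ?Q = "aff W (x + s)"
  have sub: "?P \<union> ?Q \<subseteq> X + (aff X r \<union> aff W s)"
  proof (rule Un_least)
    show "?P \<subseteq> X + (aff X r \<union> aff W s)"
      unfolding sumset_aff[symmetric] by (intro set_plus_mono2) auto
    show "?Q \<subseteq> X + (aff X r \<union> aff W s)"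
    proof
      fix z assume "z \<in> ?Q"
      then obtain w where "w \<in> W" "z = 3 * w + (x + s)" unfolding aff_def by blast
      then show "z \<in> X + (aff X r \<union> aff W s)"
        using x(1) by (intro mem_sumset[of x X "3 * w + s"] UnI2 mem_aff[of w]) simp_all
    qed
  qed
  have disj: "?P \<inter> ?Q = {}"
  proof (rule ccontr)
    assume "?P \<inter> ?Q \<noteq> {}"
    then obtain y u w where "y \<in> X" "y + 3 * u + r = 3 * w + (x + s)"
      unfolding set_plus_def aff_def elt_set_times_def by blast
    moreover from this have "(x + s) mod 3 = (y + r) mod 3" by presburger
    ultimately show False using x by blast
  qed
  have fin: "finite ?P" "finite ?Q" using assms by (auto intro: finite_set_plus finite_dilate)
  have "card ?P = card (X + 3 *o X)" by (intro card_image) (auto simp: inj_on_def)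
  then have "card (X + 3 *o X) + card W = card (?P \<union> ?Q)"
    using card_Un_disjoint[OF fin disj] by simp
  also have "\<dots> \<le> card (X + (aff X r \<union> aff W s))"
    using sub assms by (intro card_mono finite_set_plus) auto
  finally show ?thesis .
qed

lemma card_full_ge_3:
  assumes "finite X" "full X"
  shows "3 \<le> card X"
proof -
  have "{0, 1, 2} \<subseteq> (\<lambda>x. x mod 3) ` X"
  proof
    fix r :: int
    assume "r \<in> {0, 1, 2}"
    then have "r mod 3 = r" by auto
    moreover obtain x where "x \<in> X" "x mod 3 = r mod 3" using assms unfolding full_def by blast
    ultimately show "r \<in> (\<lambda>x. x mod 3) ` X" by force
  qed
  then have "card {0, 1, 2 :: int} \<le> card X"
    using assms(1) by (meson card_image_le card_mono finite_imageI le_trans)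
  then show ?thesis by simp
qed

lemma card_sum_dilate_ge:
  assumes "finite X" "X \<noteq> {}"
  shows "2 * card X \<le> card (X + 3 *o (X::int set)) + 1"
proof -
  have eq: "3 *o X = (*) 3 ` X" by (auto simp: elt_set_times_def)
  have "card (3 *o X) = card X" unfolding eq by (intro card_image) (auto simp: inj_on_def)
  then show ?thesis
    using card_sumset_ge[of X "3 *o X"] assms by (simp add: eq)
qed

section \<open>The case of two classes\<close>

lemma two_classes:
  assumes fin: "finite X" "finite W" and ne: "X \<noteq> {}" "W \<noteq> {}" and rs: "r mod 3 \<noteq> s mod 3"
    and IH: "4 * card X \<le> card (X + 3 *o X) + 6" "4 * card W \<le> card (W + 3 *o W) + 6"
    and A: "A = aff X r \<union> aff W s"
  shows "4 * card A \<le> card (A + 3 *o A) + 6"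
proof -
  have finA: "finite A" and neA: "A \<noteq> {}" using fin ne A by (auto simp: aff_def)
  have cA: "card A = card X + card W" using card_aff_Un[OF fin rs] A by simp
  have "A + 3 *o A = aff (X + A) r \<union> aff (W + A) s"
    by (subst (1) A) (simp only: Un_sumset aff_sumset)
  then have S: "card (A + 3 *o A) = card (X + A) + card (W + A)"
    using card_aff_Un fin finA rs by (simp add: finite_set_plus)
  have own: "card (Y + 3 *o Y) \<le> card (Y + A)" if "aff Y t \<subseteq> A" for Y t
  proof -
    have "(\<lambda>z. z + t) ` (Y + 3 *o Y) \<subseteq> Y + A"
      using that unfolding sumset_aff[symmetric] by (intro set_plus_mono2) auto
    moreover have "finite Y" using that finA by (metis finite_aff finite_subset)
    ultimately have "card ((\<lambda>z. z + t) ` (Y + 3 *o Y)) \<le> card (Y + A)"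
      using finA by (intro card_mono finite_set_plus) auto
    then show ?thesis by (simp add: card_image inj_on_def)
  qed
  have X1: "card (X + 3 *o X) \<le> card (X + A)" and W1: "card (W + 3 *o W) \<le> card (W + A)"
    using own A by blast+
  have X2: "card (X + 3 *o X) + card W \<le> card (X + A)" if "\<not> full X"
    using card_not_full[OF fin ne(1) that rs] A by simp
  have W2: "card (W + 3 *o W) + card X \<le> card (W + A)" if "\<not> full W"
    using card_not_full[OF fin(2,1) ne(2) that rs[symmetric]] A by (simp add: Un_commute)
  consider "full X" "full W" | "full X" "\<not> full W" | "\<not> full X" "full W" | "\<not> full X" "\<not> full W" by blast
  then show ?thesis
  proof cases
    case 1
    \<comment> \<open>Each full class loses 3, together exactly the 6 allowed.\<close>
    then show ?thesis using card_full[of X] card_full[of W] fin cA S X1 W1 by linarith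
  next
    case 2
    \<comment> \<open>The losses, 3 for \<open>X\<close> and 6 for \<open>W\<close>, add up to 9;
      the term |X| >= 3 gained in \<open>W2\<close> brings this back to 6.\<close>
    then show ?thesis using card_full[of X] card_full_ge_3[of X] fin IH W2 cA S X1 by linarith
  next
    case 3
    then show ?thesis using card_full[of W] card_full_ge_3[of W] fin IH X2 cA S W1 by linarith
  next
    case 4
    \<comment> \<open>For |A| = 5 these bounds sum to 13, as do those from the induction hypothesis,
      one short of 14. Using the former for the smaller class and the latter for the larger gives at
      least 14.\<close>
    have "card X + card A \<le> card (X + A) + 1" "card W + card A \<le> card (W + A) + 1"
      using card_sumset_ge fin finA ne neA by blast+
    moreover note X2[OF 4(1)] W2[OF 4(2)] IH cA S
      card_sum_dilate_ge[OF fin(1) ne(1)] card_sum_dilate_ge[OF fin(2) ne(2)]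
    moreover have "card A \<le> 4 \<or> card A = 5 \<and> card X \<le> 2 \<or> card A = 5 \<and> card W \<le> 2 \<or> 6 \<le> card A"
      using cA by linarith
    \<comment> \<open>The induction hypothesis settles \<open>|A| \<ge> 6\<close>, and the bounds on \<open>|X + A|\<close> and \<open>|W + A|\<close> settle \<open>|A| \<le> 4\<close>;
      for \<open>|A| = 5\<close> one of the classes has at most two elements.\<close>
    ultimately show ?thesis by (elim disjE conjE) linarith+
  qed
qed

section \<open>Induction on the diameter\<close>

lemma class_diameter:
  assumes "A \<subseteq> {a..a + int n}"
  shows "\<exists>b. {x. 3 * x + r \<in> A} \<subseteq> {b..b + int (n div 3)}"
proof -
  \<comment> \<open>\<open>- q\<close> is (a - r) / 3 rounded up, the least \<open>x\<close> with
    \<open>a \<le> 3 * x + r\<close>.\<close>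
  define q where "q = (r - a) div 3"
  have q: "3 * q \<le> r - a" "r - a \<le> 3 * q + 2" unfolding q_def by presburger+
  have n: "n \<le> 3 * (n div 3) + 2" by presburger
  have "{x. 3 * x + r \<in> A} \<subseteq> {- q..- q + int (n div 3)}"
  proof
    fix x assume "x \<in> {x. 3 * x + r \<in> A}"
    then have "a \<le> 3 * x + r" "3 * x + r \<le> a + int n" using assms by auto
    then show "x \<in> {- q..- q + int (n div 3)}"
      using q n by auto
  qed
  then show ?thesis by blast
qed

lemma card_sum_dilate_3:
  assumes "A \<subseteq> {a..a + int n}"
  shows "4 * card A \<le> card (A + 3 *o A) + 6"
  using assms
proof (induction n arbitrary: A a rule: less_induct)
  case (less n)
  show ?case
  proof (cases "n = 0")
    case True
    then have "card A \<le> card {a}" using less.prems by (intro card_mono) auto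
    then show ?thesis by simp
  next
    case False
    have finA: "finite A" using less.prems finite_subset by blast
    \<comment> \<open>The induction hypothesis applies because \<open>n div 3 < n\<close> for
      nonzero \<open>n\<close>.\<close>
    have IH: "4 * card {x. 3 * x + r \<in> A} \<le> card ({x. 3 * x + r \<in> A} + 3 *o {x. 3 * x + r \<in> A}) + 6" for r
      using less.IH[of "n div 3"] class_diameter[OF less.prems, of r] False by force
    have fin: "finite {x. 3 * x + r \<in> A}" for r
      using class_diameter[OF less.prems, of r] finite_subset by blast
    define X where "X r = {x. 3 * x + r \<in> A}" for r
    note IH = IH[folded X_def] and fin = fin[folded X_def]
    have A: "A = aff (X 0) 0 \<union> aff (X 1) 1 \<union> aff (X 2) 2"
      using aff_classes[of A] by (simp add: X_def)
    \<comment> \<open>Here \<open>A + 3 *o A\<close> is the image of \<open>X r + 3 *o X r\<close>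
      under the injective map sending z to 3 * (z + r) + r, so the bound carries over without
      loss.\<close>
    have one: ?thesis if "A = aff (X r) r" for r
    proof -
      have "A + 3 *o A = aff (X r + A) r" by (subst (1) that) (rule aff_sumset)
      moreover have "X r + A = (\<lambda>z. z + r) ` (X r + 3 *o X r)"
        by (subst that) (rule sumset_aff)
      ultimately have "card (A + 3 *o A) = card (X r + 3 *o X r)"
        by (simp add: card_image inj_on_def)
      moreover have "card A = card (X r)" by (subst that) simp
      ultimately show ?thesis using IH[of r] by simp
    qed
    have two: ?thesis if "A = aff (X r) r \<union> aff (X s) s" "r mod 3 \<noteq> s mod 3" for r s
    proof (cases "X r = {} \<or> X s = {}")
      case True
      then show ?thesis using one that by (metis aff_empty sup_bot.left_neutral sup_bot.right_neutral)
    next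
      case False
      then show ?thesis using two_classes[OF fin fin _ _ that(2) IH IH that(1)] by blast
    qed
    consider "X 0 = {}" | "X 1 = {}" | "X 2 = {}" | "X 0 \<noteq> {}" "X 1 \<noteq> {}" "X 2 \<noteq> {}" by blast
    then show ?thesis
    proof cases
      case 1
      then show ?thesis using two[of 1 2] A by simp
    next
      case 2
      then show ?thesis using two[of 0 2] A by simp
    next
      case 3
      then show ?thesis using two[of 0 1] A by simp
    next
      case 4
      then obtain x y z where xyz: "3 * x + 0 \<in> A" "3 * y + 1 \<in> A" "3 * z + 2 \<in> A"
        unfolding X_def by blast
      have "t mod 3 = (3 * x + 0) mod 3 \<or> t mod 3 = (3 * y + 1) mod 3 \<or> t mod 3 = (3 * z + 2) mod 3"
        for t :: int by presburger
      then have "full A" unfolding full_def using xyz by metis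
      then show ?thesis using card_full[OF finA] by simp
    qed
  qed
qed

theorem theorem1:
  shows "\<exists>C::real. \<forall>A::int set. finite A \<longrightarrow>
    real (card (A + (3 *o A))) \<ge> 4 * real (card A) - C"
proof (intro exI allI impI)
  fix A :: "int set"
  assume A: "finite A"
  \<comment> \<open>For empty \<open>A\<close> the values of \<open>Min\<close> and
    \<open>Max\<close> are unspecified, but the inclusion is trivial.\<close>
  have "A \<subseteq> {Min A..Min A + int (nat (Max A - Min A))}"
    using A by (fastforce dest: Min_le Max_ge)
  from card_sum_dilate_3[OF this]
  show "real (card (A + (3 *o A))) \<ge> 4 * real (card A) - 6" by linarith
qed

end
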